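(* Let $m,\ell$ be coprime integers with $\ell>m$, let $c_1,c_2$ be nonzero real numbers, and let $f(t)=c_1e^{itm}+c_2e^{it\ell}$, $t\in\mathbb{R}$. Suppose that $w_0=f(t_0)=f(s_0)\neq0$ $(t_0\not\equiv s_0\bmod 2\pi)$ is a self-intersection point of the curve $f$. If $\ell-m=2s$ and $s$ is odd, then either two and only two members of the module class $\{w_k:0\le k\le\ell-m-1\}$, $w_k=f\big(t_0+\tfrac{2k\pi}{\ell-m}\big)$, belong to the axis $y=0$, or two and only two members of this module class belong to the axis $x=0$.
   Context: Points of $\mathbb{C}$ are written $x+iy$, so the axis $y=0$ is the real axis and $x=0$ is the imaginary axis. Write $f=x+iy$ with $x,y$ real-valued. The point $w_0=f(t_0)=f(s_0)$ is a self-intersection point of the curve $f$ if the curve has different tangent lines there, i.e. $\dot y(t_0)/\dot x(t_0)\neq\dot y(s_0)/\dot x(s_0)$ (slope $\infty$ allowed when $\dot x=0\ne\dot y$). With $t_k=t_0+2k\pi/(\ell-m)$ and $s_k=s_0+2k\pi/(\ell-m)$, the self-intersection points $w_k=f(t_k)=f(s_k)$, $0\le k\le\ell-m-1$, form the module class of $w_0$. *)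

theory Defs
  imports "HOL-Analysis.Analysis" "HOL-Library.Real_Mod"
begin

definition two_term_curve :: "real \<Rightarrow> real \<Rightarrow> int \<Rightarrow> int \<Rightarrow> real \<Rightarrow> complex" where
  "two_term_curve c1 c2 m l t =
     of_real c1 * exp (\<i> * of_real t * of_int m) + of_real c2 * exp (\<i> * of_real t * of_int l)"

definition xdot :: "(real \<Rightarrow> complex) \<Rightarrow> real \<Rightarrow> real" where
  "xdot f t = deriv (\<lambda>u. Re (f u)) t"

definition ydot :: "(real \<Rightarrow> complex) \<Rightarrow> real \<Rightarrow> real" where
  "ydot f t = deriv (\<lambda>u. Im (f u)) t"

text \<open>A tangent line has a slope only where the velocity does not vanish.\<close>

definition has_slope :: "(real \<Rightarrow> complex) \<Rightarrow> real \<Rightarrow> bool" where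
  "has_slope f t \<longleftrightarrow> xdot f t \<noteq> 0 \<or> ydot f t \<noteq> 0"

text \<open>The slope is meant to be used under \<open>has_slope f t\<close>; the value \<open>\<infinity>\<close> is the unsigned
  slope of a vertical line.\<close>

definition slope :: "(real \<Rightarrow> complex) \<Rightarrow> real \<Rightarrow> ereal" where
  "slope f t = (if xdot f t = 0 then \<infinity> else ereal (ydot f t / xdot f t))"

definition self_intersection :: "(real \<Rightarrow> complex) \<Rightarrow> complex \<Rightarrow> real \<Rightarrow> real \<Rightarrow> bool" where
  "self_intersection f w t0 s0 \<longleftrightarrow>
     w = f t0 \<and> w = f s0 \<and> has_slope f t0 \<and> has_slope f s0 \<and> slope f t0 \<noteq> slope f s0"

text \<open>For a self-intersection point \<open>f t0 = f s0\<close> of \<open>two_term_curve c1 c2 m l\<close> one takes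
  \<open>n = l - m\<close>; the translates of \<open>s0\<close> yield the same points \<open>w\<^sub>k\<close>.\<close>

definition module_class :: "(real \<Rightarrow> complex) \<Rightarrow> int \<Rightarrow> real \<Rightarrow> complex set" where
  "module_class f n t0 = (\<lambda>k. f (t0 + 2 * of_int k * pi / of_int n)) ` {0..n - 1}"

end

theory Submission
  imports Defs "HOL-Number_Theory.Cong"
begin

text \<open>
  Put \<open>n = l - m\<close>. The whole argument lives in the \<open>n\<close>-th powers of the points of the curve.
  On the one hand, a shift of the parameter by \<open>2 * pi / n\<close> rotates the curve by an \<open>n\<close>-th root of
  unity, which is primitive because \<open>m\<close> and \<open>n\<close> are coprime; so the module class of \<open>w0 \<noteq> 0\<close>
  is the set of all solutions of \<open>w ^ n = w0 ^ n\<close> (\<open>module_class_eq_roots\<close>).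
  On the other hand, \<open>f t ^ n\<close> is a rational expression with real coefficients in \<open>cis (n * t)\<close>
  (\<open>two_term_curve_power\<close>), and \<open>norm (f t)\<close> determines \<open>cos (n * t)\<close>, that is,
  \<open>cis (n * t)\<close> up to conjugation. Two different parameters of the same nonzero point cannot have the
  same \<open>cis (n * t)\<close>: the passage from one to the other would be one of these rotations, and it would
  move the point. So their values
  \<open>cis (n * t)\<close> are conjugate, and \<open>w0 ^ n\<close> is equal to its own conjugate: it is a nonzero real
  number \<open>a\<close> (\<open>double_point_power_real\<close>).

  Now let \<open>n = 2 * s\<close> with \<open>s\<close> odd. The \<open>n\<close>-th power is positive on the punctured real axis and, as
  \<open>\<i> ^ n = -1\<close>, negative on the punctured imaginary axis. Hence the sign of \<open>a\<close> decides which axis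
  contains solutions of \<open>w ^ n = a\<close>, and that axis contains exactly two of them.
\<close>

section \<open>Rotations and powers of the curve\<close>

lemma two_term_curve_cis:
  "two_term_curve c1 c2 m l t = of_real c1 * cis (t * of_int m) + of_real c2 * cis (t * of_int l)"
  by (simp add: two_term_curve_def cis_conv_exp mult_ac)

lemma two_term_curve_factor:
  "two_term_curve c1 c2 m l t =
     cis (t * of_int m) * (of_real c1 + of_real c2 * cis (of_int (l - m) * t))"
proof -
  have "cis (t * of_int l) = cis (t * of_int m) * cis (of_int (l - m) * t)"
    by (simp add: cis_mult algebra_simps)
  then show ?thesis
    by (simp add: two_term_curve_cis algebra_simps)
qed

lemma two_term_curve_shift:
  assumes "l \<noteq> m"
  shows "two_term_curve c1 c2 m l (t + 2 * of_int k * pi / of_int (l - m)) =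
     cis (2 * pi * of_int (k * m) / of_int (l - m)) * two_term_curve c1 c2 m l t"
proof -
  have nz: "real_of_int (l - m) \<noteq> 0" using assms by simp
  have 1: "of_int (l - m) * (t + 2 * of_int k * pi / of_int (l - m))
           = of_int (l - m) * t + 2 * pi * of_int k"
    using nz by (simp add: field_simps del: of_int_diff)
  have 2: "cis (of_int (l - m) * (t + 2 * of_int k * pi / of_int (l - m))) = cis (of_int (l - m) * t)"
    unfolding 1 by (simp add: cis_mult [symmetric])
  have 3: "cis ((t + 2 * of_int k * pi / of_int (l - m)) * of_int m)
      = cis (2 * pi * of_int (k * m) / of_int (l - m)) * cis (t * of_int m)"
    by (simp add: cis_mult algebra_simps)
  show ?thesis
    unfolding two_term_curve_factor 2 3 by (simp only: mult.assoc)
qed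

lemma cis_eq_1_iff_dvd:
  fixes j n :: int
  assumes "n \<noteq> 0"
  shows "cis (2 * pi * of_int j / of_int n) = 1 \<longleftrightarrow> n dvd j"
proof
  assume "cis (2 * pi * of_int j / of_int n) = 1"
  then have "cos (2 * pi * of_int j / of_int n) = 1"
    by (simp add: complex_eq_iff)
  then obtain q :: int where "2 * pi * of_int j / of_int n = of_int q * 2 * pi"
    by (auto simp: cos_one_2pi_int)
  then have "real_of_int j = of_int (n * q)"
    using assms by (simp add: field_simps)
  then show "n dvd j"
    by (metis dvd_triv_left of_int_eq_iff)
next
  assume "n dvd j"
  then obtain q where "j = n * q" by blast
  then have "cis (2 * pi * of_int j / of_int n) = cis (2 * pi * of_int q)"
    using assms by (simp add: mult.assoc del: cis_multiple_2pi)
  also have "\<dots> = 1"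
    by (intro cis_multiple_2pi) auto
  finally show "cis (2 * pi * of_int j / of_int n) = 1" .
qed

text \<open>The right-hand side depends on \<open>t\<close> only through \<open>cis (n * t)\<close>, and its coefficients are real;
  so it commutes with conjugation.\<close>

lemma two_term_curve_power:
  fixes m l :: int
  assumes "l - m = int n"
  shows "two_term_curve c1 c2 m l t ^ n =
     cis (real n * t) powi m * (of_real c1 + of_real c2 * cis (real n * t)) ^ n"
proof -
  have "cis (t * of_int m) ^ n = cis (real n * t) powi m"
    by (simp add: Complex.DeMoivre cis_power_int mult_ac)
  then show ?thesis
    using assms by (simp add: two_term_curve_factor power_mult_distrib flip: of_int_diff)
qed

text \<open>The law of cosines: \<open>(l - m) * t\<close> is the angle between the two rotating summands.\<close>

lemma norm_two_term_curve:
  "(norm (two_term_curve c1 c2 m l t))\<^sup>2 = c1\<^sup>2 + c2\<^sup>2 + 2 * c1 * c2 * cos (of_int (l - m) * t)"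
proof -
  define x where "x = of_int (l - m) * t"
  have "(norm (two_term_curve c1 c2 m l t))\<^sup>2 = (c1 + c2 * cos x)\<^sup>2 + (c2 * sin x)\<^sup>2"
    by (simp add: two_term_curve_factor norm_mult cmod_power2 x_def)
  also have "\<dots> = c1\<^sup>2 + c2\<^sup>2 * ((sin x)\<^sup>2 + (cos x)\<^sup>2) + 2 * c1 * c2 * cos x"
    unfolding power2_eq_square by algebra
  finally show ?thesis by (simp add: x_def)
qed

lemma cis_eq_or_cnj_of_cos_eq:
  assumes "cos x = cos y"
  shows "cis x = cis y \<or> cis x = cnj (cis y)"
proof -
  have "(sin x)\<^sup>2 = (sin y)\<^sup>2"
    using assms by (simp add: sin_squared_eq)
  then show ?thesis
    using assms by (auto simp: power2_eq_iff complex_eq_iff)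
qed

section \<open>Double points and their module classes\<close>

text \<open>Such parameters differ by a multiple of \<open>2 * pi / (l - m)\<close>, hence the corresponding points by a
  rotation; a nonzero point is fixed only by the trivial rotation, which by coprimality comes only from
  multiples of \<open>2 * pi\<close>.\<close>

lemma parameter_unique_of_cis_eq:
  assumes "coprime m l" and "l \<noteq> m"
    and "two_term_curve c1 c2 m l t = two_term_curve c1 c2 m l u"
    and "two_term_curve c1 c2 m l t \<noteq> 0"
    and "cis (of_int (l - m) * u) = cis (of_int (l - m) * t)"
  shows "[t = u] (rmod (2 * pi))"
proof -
  define n where "n = l - m"
  have n: "n \<noteq> 0" "coprime n m"
    using assms(1,2) by (auto simp: n_def coprime_commute) (metis coprime_iff_gcd_eq_1 gcd.commute gcd_diff1)
  have "sin (of_int n * u) = sin (of_int n * t) \<and> cos (of_int n * u) = cos (of_int n * t)"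
    using assms(5) by (simp add: n_def complex_eq_iff)
  then obtain k :: int where k: "of_int n * u = of_int n * t + 2 * pi * of_int k"
    by (auto simp: sin_cos_eq_iff)
  then have u: "u = t + 2 * of_int k * pi / of_int n"
    using n by (simp add: field_simps)
  have "cis (2 * pi * of_int (k * m) / of_int n) = 1"
    using two_term_curve_shift[OF assms(2), of c1 c2 t k] assms(3,4) u by (simp add: n_def)
  then have "n dvd k * m"
    by (simp only: cis_eq_1_iff_dvd[OF n(1)])
  then obtain q where "k = n * q"
    using n(2) by (metis coprime_dvd_mult_left_iff dvdE)
  then have "u = t + of_int q * (2 * pi)"
    using u n by simp
  then show ?thesis
    by (auto simp: rcong_altdef)
qed

lemma double_point_power_real:
  assumes "coprime m l" and "l - m = int n" and "n > 0" and "c1 \<noteq> 0" and "c2 \<noteq> 0"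
    and "w = two_term_curve c1 c2 m l t" and "w = two_term_curve c1 c2 m l u"
    and "w \<noteq> 0" and "\<not> [t = u] (rmod (2 * pi))"
  shows "w ^ n \<in> \<real>"
proof -
  have "cos (real n * u) = cos (real n * t)"
    using norm_two_term_curve[of c1 c2 m l t] norm_two_term_curve[of c1 c2 m l u] assms
    by (simp flip: of_int_diff)
  moreover have "cis (real n * u) \<noteq> cis (real n * t)"
    using parameter_unique_of_cis_eq[OF assms(1), of c1 c2 t u] assms by auto
  ultimately have u: "cis (real n * u) = cnj (cis (real n * t))"
    using cis_eq_or_cnj_of_cos_eq by blast
  have "cnj (w ^ n) = cnj (two_term_curve c1 c2 m l t ^ n)"
    using assms by simp
  also have "\<dots> = two_term_curve c1 c2 m l u ^ n"
    unfolding two_term_curve_power[OF assms(2)] u by (simp add: cis_power_int cis_cnj)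
  also have "\<dots> = w ^ n"
    using assms by simp
  finally show ?thesis
    by (simp add: Reals_cnj_iff)
qed

text \<open>The class consists of the rotations of \<open>f t\<close> by \<open>\<zeta> ^ (k * m)\<close>, where \<open>\<zeta>\<close> is a primitive
  \<open>n\<close>-th root of unity; as \<open>m\<close> is invertible modulo \<open>n\<close>, these exponents exhaust all residues.\<close>

lemma module_class_eq_roots:
  assumes "coprime m l" and "l - m = int n" and "n > 0" and "two_term_curve c1 c2 m l t \<noteq> 0"
  shows "module_class (two_term_curve c1 c2 m l) (int n) t =
    {w. w ^ n = two_term_curve c1 c2 m l t ^ n}"
proof -
  define p where "p = two_term_curve c1 c2 m l t"
  define r where "r j = cis (2 * pi * of_int j / of_int (int n))" for j :: int
  have shift: "two_term_curve c1 c2 m l (t + 2 * of_int k * pi / of_int (int n)) = r (k * m) * p" for k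
    using two_term_curve_shift[of l m c1 c2 t k] assms(2,3) by (simp add: p_def r_def flip: of_int_diff)
  have class_eq: "module_class (two_term_curve c1 c2 m l) (int n) t = (\<lambda>k. r (k * m) * p) ` {0..int n - 1}"
    unfolding module_class_def shift ..
  have r_power: "r j ^ n = 1" for j
    using assms(3) by (simp add: r_def Complex.DeMoivre)
  have r_cong: "r i = r j" if "[i = j] (mod int n)" for i j
  proof -
    have "int n dvd i - j"
      using that by (simp add: cong_iff_dvd_diff)
    then have "r (i - j) = 1"
      unfolding r_def using cis_eq_1_iff_dvd[of "int n" "i - j"] assms(3) by simp
    moreover have "r i = r (i - j) * r j"
      by (simp add: r_def cis_mult diff_divide_distrib algebra_simps)
    ultimately show ?thesis by simp
  qed
  have "coprime m (int n)"
    using assms(1,2) by (metis coprime_iff_gcd_eq_1 gcd.commute gcd_diff1)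
  then obtain m' where m': "[m * m' = 1] (mod int n)"
    using cong_solve_coprime_int by blast
  show ?thesis
  proof (intro equalityI subsetI)
    fix w assume "w \<in> module_class (two_term_curve c1 c2 m l) (int n) t"
    then show "w \<in> {w. w ^ n = two_term_curve c1 c2 m l t ^ n}"
      by (auto simp: class_eq power_mult_distrib r_power p_def)
  next
    fix w assume "w \<in> {w. w ^ n = two_term_curve c1 c2 m l t ^ n}"
    then have "(w / p) ^ n = 1"
      using assms(4) by (simp add: power_divide p_def)
    then obtain j :: nat where j: "w / p = r (int j)"
      using Complex.bij_betw_roots_unity[OF assms(3)] by (auto simp: bij_betw_def r_def)
    define k where "k = (int j * m') mod int n"
    have "[k * m = int j * m' * m] (mod int n)"
      unfolding k_def by (intro cong_scalar_right) (simp add: cong_def)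
    also have "int j * m' * m = int j * (m * m')"
      by (simp add: mult_ac)
    also have "[int j * (m * m') = int j * 1] (mod int n)"
      by (intro cong_scalar_left m')
    finally have "r (k * m) = w / p"
      using r_cong j by simp
    moreover have "k \<in> {0..int n - 1}"
      using assms(3) by (simp add: k_def)
    ultimately show "w \<in> module_class (two_term_curve c1 c2 m l) (int n) t"
      using assms(4) by (auto simp: class_eq p_def intro!: image_eqI[of _ _ k])
  qed
qed

section \<open>Even roots on the coordinate axes\<close>

lemma card_roots_real_axis:
  fixes a :: real
  assumes "even n" and "n > 0" and "a \<noteq> 0"
  shows "card {w :: complex. w ^ n = of_real a \<and> Im w = 0} = (if a > 0 then 2 else 0)"
proof -
  have "{w :: complex. w ^ n = of_real a \<and> Im w = 0} = of_real ` {x. x ^ n = a}"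
  proof (intro equalityI subsetI)
    fix w :: complex assume w: "w \<in> {w. w ^ n = of_real a \<and> Im w = 0}"
    then obtain x where x: "w = of_real x"
      using complex_is_Real_iff[of w] by (auto elim: Reals_cases)
    with w have "complex_of_real (x ^ n) = of_real a" by simp
    then have "x ^ n = a" by (simp only: of_real_eq_iff)
    then show "w \<in> of_real ` {x. x ^ n = a}" unfolding x by simp
  qed auto
  then have "card {w :: complex. w ^ n = of_real a \<and> Im w = 0} = card {x. x ^ n = a}"
    by (simp add: card_image inj_on_def)
  also have "\<dots> = (if a > 0 then 2 else 0)"
  proof (cases "a > 0")
    case True
    define b where "b = root n a"
    have b: "b > 0" "b ^ n = a"
      using True assms by (auto simp: b_def)
    have "x ^ n = a \<longleftrightarrow> x = b \<or> x = - b" for x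
    proof -
      have "x ^ n = a \<longleftrightarrow> \<bar>x\<bar> ^ n = b ^ n"
        by (simp only: b power_even_abs[OF assms(1)])
      also have "\<dots> \<longleftrightarrow> \<bar>x\<bar> = b"
        using assms(2) b(1) by (intro power_eq_iff_eq_base) auto
      also have "\<dots> \<longleftrightarrow> x = b \<or> x = - b"
        using b(1) by auto
      finally show ?thesis .
    qed
    then have "{x. x ^ n = a} = {b, - b}" by auto
    then show ?thesis using True b by simp
  next
    case False
    have "{x. x ^ n = a} = {}"
    proof -
      have "x ^ n \<noteq> a" for x
        using False assms(3) zero_le_even_power[OF assms(1), of x] by linarith
      then show ?thesis by blast
    qed
    then show ?thesis using False by simp
  qed
  finally show ?thesis .
qed

text \<open>Multiplication by \<open>\<i>\<close> exchanges the axes, and negates the \<open>n\<close>-th power for \<open>n = 2 * q\<close>,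
  \<open>q\<close> odd.\<close>

lemma card_roots_imaginary_axis:
  fixes a :: real
  assumes "n = 2 * q" and "odd q" and "a \<noteq> 0"
  shows "card {w :: complex. w ^ n = of_real a \<and> Re w = 0} = (if a < 0 then 2 else 0)"
proof -
  have i: "\<i> ^ n = -1"
    using assms by (simp add: power_mult)
  have "{w :: complex. w ^ n = of_real a \<and> Re w = 0} =
        (\<lambda>v. \<i> * v) ` {v. v ^ n = of_real (- a) \<and> Im v = 0}"
  proof (intro equalityI subsetI)
    fix w :: complex assume w: "w \<in> {w. w ^ n = of_real a \<and> Re w = 0}"
    define v where "v = - \<i> * w"
    have v: "w = \<i> * v"
      by (simp add: v_def flip: mult.assoc)
    have "v ^ n = of_real (- a)" and "Im v = 0"
      using w unfolding v by (simp_all add: power_mult_distrib i minus_equation_iff[of "v ^ n"])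
    then show "w \<in> (\<lambda>v. \<i> * v) ` {v. v ^ n = of_real (- a) \<and> Im v = 0}"
      using v by blast
  qed (auto simp: power_mult_distrib i)
  moreover have "card {v :: complex. v ^ n = of_real (- a) \<and> Im v = 0} = (if - a > 0 then 2 else 0)"
    using assms by (intro card_roots_real_axis) (auto intro: Nat.gr0I)
  ultimately show ?thesis
    by (simp add: card_image inj_on_def)
qed

theorem corollary5p9:
  fixes m l s :: int and c1 c2 t0 s0 :: real and w0 :: complex and f :: "real \<Rightarrow> complex"
  assumes "coprime m l" and "l > m"
    and "c1 \<noteq> 0" and "c2 \<noteq> 0"
    and "f = two_term_curve c1 c2 m l"
    and "\<not> [t0 = s0] (rmod (2 * pi))"
    and "self_intersection f w0 t0 s0" and "w0 \<noteq> 0"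
    and "l - m = 2 * s" and "odd s"
  shows "(card {w \<in> module_class f (l - m) t0. Im w = 0} = 2 \<or>
          card {w \<in> module_class f (l - m) t0. Re w = 0} = 2) \<and>
         \<not> (card {w \<in> module_class f (l - m) t0. Im w = 0} = 2 \<and>
            card {w \<in> module_class f (l - m) t0. Re w = 0} = 2)"
proof -
  define q where "q = nat s"
  define n where "n = 2 * q"
  have q: "int q = s" "odd q"
    using assms(2,9,10) by (auto simp: q_def even_nat_iff)
  have n: "l - m = int n" "n > 0" "even n"
    using q assms(2,9) by (auto simp: n_def)
  have w0: "w0 = two_term_curve c1 c2 m l t0" "w0 = two_term_curve c1 c2 m l s0"
    using assms(7) unfolding self_intersection_def assms(5) by auto
  have "w0 ^ n \<in> \<real>"
    using double_point_power_real[OF assms(1) n(1,2) assms(3,4) w0 assms(8,6)] .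
  then obtain a where a: "w0 ^ n = of_real a"
    by (auto elim: Reals_cases)
  have "a \<noteq> 0"
    using a assms(8) by auto
  have "module_class f (l - m) t0 = {w. w ^ n = of_real a}"
    using module_class_eq_roots[OF assms(1) n(1,2), of c1 c2 t0] w0 assms(5,8) n(1) a by simp
  then show ?thesis
    using card_roots_real_axis[OF n(3,2) \<open>a \<noteq> 0\<close>]
      card_roots_imaginary_axis[OF n_def q(2) \<open>a \<noteq> 0\<close>] \<open>a \<noteq> 0\<close>
    by auto
qed

end
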